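(* For positive integers $n_1$ and $n$ with $1\le n_1<n$, $$|AMT(1,n)|=1+\sum_{\alpha\in AMT(1,n_1)\setminus\{\emptyset\},\ \beta\in AMT(n_1+1,n)\setminus\{\emptyset\}}\big|[\alpha\vee\beta,\ \alpha\times\beta]\big|.$$
   Context: For a finite set $N$ of positive integers, an antimonotonic function on $2^N$ is a boolean function on $2^N$, identified with the set $\alpha$ of subsets of $N$ on which it is true, such that no element of $\alpha$ is a proper subset of another element of $\alpha$. $AMT(N)$ is the set of all of them (both $\emptyset$ and $\{\emptyset\}$ belong to it); $AMT(a,b)$ denotes $AMT(\{a,a+1,\dots,b\})$ for integers $a\le b$. Order: $\alpha\le\beta$ iff every $A\in\alpha$ is contained in some $B\in\beta$. The interval $[\alpha,\beta]$ is the set of antimonotonic functions $\kappa\in AMT(1,n)$ with $\alpha\le\kappa\le\beta$. For a family $\mathcal{S}$ of sets, $\sup(\mathcal{S})$ is the set of inclusion-maximal members of $\mathcal{S}$. The span is $sp(\alpha)=\bigcup_{A\in\alpha}A$. Join: $\alpha\vee\beta=\sup(\alpha\cup\beta)$. External product: $\alpha\times\beta=\sup\{(A\setminus sp(\beta))\cup(B\setminus sp(\alpha))\cup(A\cap B)\mid A\in\alpha,\,B\in\beta\}$; for $\alpha,\beta\neq\emptyset$ this is the largest antimonotonic $\kappa$ with $sp(\kappa)=sp(\alpha)\cup sp(\beta)$, $\sup\{K\cap sp(\alpha)\mid K\in\kappa\}\le\alpha$ and $\sup\{K\cap sp(\beta)\mid K\in\kappa\}\le\beta$. *)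

theory Defs
  imports Main
begin

text \<open>A boolean function on the power set of \<open>N\<close> is represented by the set of subsets of \<open>N\<close> on
  which it is true.\<close>

definition AMT :: "'a set \<Rightarrow> 'a set set set" where
  "AMT N = {\<alpha>. \<alpha> \<subseteq> Pow N \<and> (\<forall>A\<in>\<alpha>. \<forall>B\<in>\<alpha>. \<not> A \<subset> B)}"

definition am_le :: "'a set set \<Rightarrow> 'a set set \<Rightarrow> bool" (infix \<open>\<preceq>\<close> 50) where
  "\<alpha> \<preceq> \<beta> \<longleftrightarrow> (\<forall>A\<in>\<alpha>. \<exists>B\<in>\<beta>. A \<subseteq> B)"

definition am_interval :: "'a set \<Rightarrow> 'a set set \<Rightarrow> 'a set set \<Rightarrow> 'a set set set" where
  "am_interval N \<alpha> \<beta> = {\<kappa> \<in> AMT N. \<alpha> \<preceq> \<kappa> \<and> \<kappa> \<preceq> \<beta>}"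

text \<open>Inclusion-maximal members of a family; this is not the lattice supremum \<^const>\<open>Sup\<close>.\<close>

definition max_sets :: "'a set set \<Rightarrow> 'a set set" where
  "max_sets S = {A \<in> S. \<forall>B\<in>S. \<not> A \<subset> B}"

definition sp :: "'a set set \<Rightarrow> 'a set" where
  "sp \<alpha> = \<Union>\<alpha>"

definition am_join :: "'a set set \<Rightarrow> 'a set set \<Rightarrow> 'a set set" (infixl \<open>\<squnion>\<close> 65) where
  "\<alpha> \<squnion> \<beta> = max_sets (\<alpha> \<union> \<beta>)"

definition ext_prod :: "'a set set \<Rightarrow> 'a set set \<Rightarrow> 'a set set" (infixl \<open>\<otimes>\<close> 70) where
  "\<alpha> \<otimes> \<beta> = max_sets {(A - sp \<beta>) \<union> (B - sp \<alpha>) \<union> (A \<inter> B) | A B. A \<in> \<alpha> \<and> B \<in> \<beta>}"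

end

theory Submission
  imports Defs
begin

text \<open>
  Split the ground set into disjoint parts \<open>P\<close> and \<open>Q\<close>. A nonempty antimonotonic function
  \<open>\<kappa>\<close> on \<open>P \<union> Q\<close> has two shadows: the maximal members of \<open>{K \<inter> P | K \<in> \<kappa>}\<close> and of
  \<open>{K \<inter> Q | K \<in> \<kappa>}\<close>, which are nonempty antimonotonic functions on \<open>P\<close> and on \<open>Q\<close>. Counting
  the \<open>\<kappa>\<close> by their pair of shadows gives the formula, the summand \<open>1\<close> being the empty function,
  provided that the \<open>\<kappa>\<close> with shadows \<open>\<alpha>\<close> and \<open>\<beta>\<close> are exactly the members of the interval
  \<open>[\<alpha> \<squnion> \<beta>, \<alpha> \<otimes> \<beta>]\<close>.

  This holds because the two ends of the interval are universal. An antichain is the set of maximal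
  members of a finite family iff the two are mutually below each other in \<open>\<preceq>\<close>
  (\<open>max_sets_eq_iff\<close>), so having shadows \<open>\<alpha>\<close> and \<open>\<beta>\<close> amounts to four comparisons. The two
  lower ones, of \<open>\<alpha>\<close> and \<open>\<beta>\<close> with the traces, say \<open>\<alpha> \<preceq> \<kappa>\<close> and \<open>\<beta> \<preceq> \<kappa>\<close>, that is
  \<open>\<alpha> \<squnion> \<beta> \<preceq> \<kappa>\<close> (\<open>join_le_iff\<close>). The two upper ones say that every \<open>K \<in> \<kappa>\<close> lies in some
  \<open>A \<union> B\<close> with \<open>A \<in> \<alpha>\<close>, \<open>B \<in> \<beta>\<close>, and for disjoint spans these unions are what \<open>\<alpha> \<otimes> \<beta>\<close>
  is made of, so they say \<open>\<kappa> \<preceq> \<alpha> \<otimes> \<beta>\<close> (\<open>le_ext_prod_iff\<close>).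
\<close>

lemma am_le_trans: "\<alpha> \<preceq> \<beta> \<Longrightarrow> \<beta> \<preceq> \<gamma> \<Longrightarrow> \<alpha> \<preceq> \<gamma>"
  unfolding am_le_def by (meson order_trans)

lemma max_sets_le: "max_sets S \<preceq> S"
  unfolding am_le_def max_sets_def by blast

lemma le_max_sets:
  assumes "finite S"
  shows "S \<preceq> max_sets S"
  unfolding am_le_def
proof
  fix A assume "A \<in> S"
  then obtain B where "B \<in> S" "A \<subseteq> B" "\<forall>C\<in>S. B \<subseteq> C \<longrightarrow> B = C"
    using finite_has_maximal2[OF assms] by metis
  then show "\<exists>B\<in>max_sets S. A \<subseteq> B"
    unfolding max_sets_def by blast
qed

lemma max_sets_le_iff: "finite S \<Longrightarrow> max_sets S \<preceq> \<kappa> \<longleftrightarrow> S \<preceq> \<kappa>"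
  using am_le_trans[of "max_sets S" S \<kappa>] am_le_trans[of S "max_sets S" \<kappa>]
    max_sets_le[of S] le_max_sets[of S] by blast

lemma le_max_sets_iff: "finite S \<Longrightarrow> \<kappa> \<preceq> max_sets S \<longleftrightarrow> \<kappa> \<preceq> S"
  using am_le_trans[of \<kappa> S "max_sets S"] am_le_trans[of \<kappa> "max_sets S" S]
    max_sets_le[of S] le_max_sets[of S] by blast

text \<open>On antichains \<open>\<preceq>\<close> is antisymmetric, and a finite family is equivalent to its antichain of
  maximal members.\<close>

lemma max_sets_eq_iff:
  assumes "finite S" and antichain: "\<forall>A\<in>\<alpha>. \<forall>B\<in>\<alpha>. \<not> A \<subset> B"
  shows "max_sets S = \<alpha> \<longleftrightarrow> \<alpha> \<preceq> S \<and> S \<preceq> \<alpha>"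
proof
  assume "max_sets S = \<alpha>"
  then show "\<alpha> \<preceq> S \<and> S \<preceq> \<alpha>"
    using max_sets_le le_max_sets[OF assms(1)] by blast
next
  assume le: "\<alpha> \<preceq> S \<and> S \<preceq> \<alpha>"
  have "A \<in> \<alpha>" if A: "A \<in> max_sets S" for A
  proof -
    obtain B where B: "B \<in> \<alpha>" "A \<subseteq> B"
      using A le unfolding max_sets_def am_le_def by blast
    moreover obtain C where "C \<in> S" "B \<subseteq> C"
      using B(1) le unfolding am_le_def by blast
    ultimately have "A = B"
      using A unfolding max_sets_def by blast
    with B show ?thesis by simp
  qed
  moreover have "A \<in> max_sets S" if A: "A \<in> \<alpha>" for A
  proof -
    have "\<not> A \<subset> D" if "D \<in> S" for D
    proof -
      obtain A' where A': "A' \<in> \<alpha>" "D \<subseteq> A'"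
        using \<open>D \<in> S\<close> le unfolding am_le_def by blast
      have "\<not> A \<subset> A'"
        using A A'(1) antichain by simp
      with A'(2) show ?thesis
        using psubset_subset_trans by metis
    qed
    moreover obtain C where "C \<in> S" "A \<subseteq> C"
      using A le unfolding am_le_def by blast
    ultimately show ?thesis
      unfolding max_sets_def by blast
  qed
  ultimately show "max_sets S = \<alpha>" by blast
qed

lemma join_le_iff:
  assumes "finite \<alpha>" "finite \<beta>"
  shows "\<alpha> \<squnion> \<beta> \<preceq> \<kappa> \<longleftrightarrow> \<alpha> \<preceq> \<kappa> \<and> \<beta> \<preceq> \<kappa>"
proof -
  have "\<alpha> \<squnion> \<beta> \<preceq> \<kappa> \<longleftrightarrow> \<alpha> \<union> \<beta> \<preceq> \<kappa>"
    unfolding am_join_def using assms by (simp add: max_sets_le_iff)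
  then show ?thesis
    unfolding am_le_def by blast
qed

text \<open>The sets \<open>A - sp \<beta>\<close> and \<open>B - sp \<alpha>\<close> in the external product are \<open>A\<close> and \<open>B\<close> themselves
  when the spans are disjoint, and \<open>A \<inter> B\<close> is empty.\<close>

lemma le_ext_prod_iff:
  assumes "finite \<alpha>" "finite \<beta>" and disj: "sp \<alpha> \<inter> sp \<beta> = {}"
  shows "\<kappa> \<preceq> \<alpha> \<otimes> \<beta> \<longleftrightarrow> (\<forall>K\<in>\<kappa>. \<exists>A\<in>\<alpha>. \<exists>B\<in>\<beta>. K \<subseteq> A \<union> B)"
proof -
  let ?U = "{A \<union> B | A B. A \<in> \<alpha> \<and> B \<in> \<beta>}"
  have union: "(A - sp \<beta>) \<union> (B - sp \<alpha>) \<union> (A \<inter> B) = A \<union> B" if "A \<in> \<alpha>" "B \<in> \<beta>" for A B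
    using that disj unfolding sp_def by blast
  have "{(A - sp \<beta>) \<union> (B - sp \<alpha>) \<union> (A \<inter> B) | A B. A \<in> \<alpha> \<and> B \<in> \<beta>} = ?U"
    by (rule Collect_cong) (metis union)
  then have "\<alpha> \<otimes> \<beta> = max_sets ?U"
    unfolding ext_prod_def by simp
  moreover have "finite ?U"
    using assms by (intro finite_image_set2) simp_all
  ultimately have "\<kappa> \<preceq> \<alpha> \<otimes> \<beta> \<longleftrightarrow> \<kappa> \<preceq> ?U"
    by (simp add: le_max_sets_iff)
  moreover have "(\<exists>X\<in>?U. R X) \<longleftrightarrow> (\<exists>A\<in>\<alpha>. \<exists>B\<in>\<beta>. R (A \<union> B))" for R
    by blast
  ultimately show ?thesis
    by (simp only: am_le_def)
qed

definition shadow :: "'a set \<Rightarrow> 'a set set \<Rightarrow> 'a set set" where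
  "shadow P \<kappa> = max_sets ((\<lambda>K. K \<inter> P) ` \<kappa>)"

lemma finite_AMT: "finite N \<Longrightarrow> finite (AMT N)"
  by (rule finite_subset[of _ "Pow (Pow N)"]) (auto simp: AMT_def)

lemma finite_mem_AMT: "finite N \<Longrightarrow> \<alpha> \<in> AMT N \<Longrightarrow> finite \<alpha>"
  by (rule finite_subset[of _ "Pow N"]) (auto simp: AMT_def)

lemma shadow_in_AMT: "shadow P \<kappa> \<in> AMT P"
  unfolding shadow_def AMT_def max_sets_def by auto

lemma shadow_eq_empty_iff:
  assumes "finite \<kappa>"
  shows "shadow P \<kappa> = {} \<longleftrightarrow> \<kappa> = {}"
proof
  assume "shadow P \<kappa> = {}"
  then have "(\<lambda>K. K \<inter> P) ` \<kappa> \<preceq> {}"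
    using le_max_sets[of "(\<lambda>K. K \<inter> P) ` \<kappa>"] assms unfolding shadow_def by simp
  then show "\<kappa> = {}"
    unfolding am_le_def by auto
qed (simp add: shadow_def max_sets_def)

lemma shadow_eq_iff:
  assumes "finite \<kappa>" "\<alpha> \<in> AMT P"
  shows "shadow P \<kappa> = \<alpha> \<longleftrightarrow> \<alpha> \<preceq> \<kappa> \<and> (\<forall>K\<in>\<kappa>. \<exists>A\<in>\<alpha>. K \<inter> P \<subseteq> A)"
proof -
  have "shadow P \<kappa> = \<alpha> \<longleftrightarrow> \<alpha> \<preceq> (\<lambda>K. K \<inter> P) ` \<kappa> \<and> (\<lambda>K. K \<inter> P) ` \<kappa> \<preceq> \<alpha>"
    unfolding shadow_def by (rule max_sets_eq_iff) (use assms in \<open>auto simp: AMT_def\<close>)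
  moreover have "\<alpha> \<preceq> (\<lambda>K. K \<inter> P) ` \<kappa> \<longleftrightarrow> \<alpha> \<preceq> \<kappa>"
  proof -
    have "A \<subseteq> P" if "A \<in> \<alpha>" for A
      using that assms(2) unfolding AMT_def by blast
    then show ?thesis
      unfolding am_le_def by (simp cong: ball_cong)
  qed
  moreover have "(\<lambda>K. K \<inter> P) ` \<kappa> \<preceq> \<alpha> \<longleftrightarrow> (\<forall>K\<in>\<kappa>. \<exists>A\<in>\<alpha>. K \<inter> P \<subseteq> A)"
    unfolding am_le_def by simp
  ultimately show ?thesis by simp
qed

text \<open>The interval is a fibre of the map that sends \<open>\<kappa>\<close> to its pair of shadows. Bounding \<open>K\<close> by a
  union \<open>A \<union> B\<close> splits into independent bounds on \<open>K \<inter> P\<close> and \<open>K \<inter> Q\<close>, because \<open>P\<close> and \<open>Q\<close>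
  are disjoint and together contain \<open>K\<close>.\<close>

lemma am_interval_eq_shadow_fibre:
  assumes fin: "finite P" "finite Q" and disj: "P \<inter> Q = {}"
    and \<alpha>: "\<alpha> \<in> AMT P" and \<beta>: "\<beta> \<in> AMT Q"
  shows "am_interval (P \<union> Q) (\<alpha> \<squnion> \<beta>) (\<alpha> \<otimes> \<beta>) =
    {\<kappa> \<in> AMT (P \<union> Q). shadow P \<kappa> = \<alpha> \<and> shadow Q \<kappa> = \<beta>}"
proof -
  have fin_ab: "finite \<alpha>" "finite \<beta>"
    using fin \<alpha> \<beta> finite_mem_AMT by blast+
  have sub: "A \<subseteq> P" if "A \<in> \<alpha>" for A
    using that \<alpha> unfolding AMT_def by blast
  have sub': "B \<subseteq> Q" if "B \<in> \<beta>" for B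
    using that \<beta> unfolding AMT_def by blast
  have spans: "sp \<alpha> \<inter> sp \<beta> = {}"
    using sub sub' disj unfolding sp_def by blast
  have "\<alpha> \<squnion> \<beta> \<preceq> \<kappa> \<and> \<kappa> \<preceq> \<alpha> \<otimes> \<beta> \<longleftrightarrow> shadow P \<kappa> = \<alpha> \<and> shadow Q \<kappa> = \<beta>"
    if \<kappa>: "\<kappa> \<in> AMT (P \<union> Q)" for \<kappa>
  proof -
    have "finite \<kappa>"
      using \<kappa> fin finite_mem_AMT by blast
    moreover have "(\<exists>A\<in>\<alpha>. \<exists>B\<in>\<beta>. K \<subseteq> A \<union> B) \<longleftrightarrow>
        (\<exists>A\<in>\<alpha>. K \<inter> P \<subseteq> A) \<and> (\<exists>B\<in>\<beta>. K \<inter> Q \<subseteq> B)" if "K \<in> \<kappa>" for K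
    proof -
      have "K \<subseteq> P \<union> Q"
        using that \<kappa> unfolding AMT_def by blast
      then have "K \<subseteq> A \<union> B \<longleftrightarrow> K \<inter> P \<subseteq> A \<and> K \<inter> Q \<subseteq> B" if "A \<in> \<alpha>" "B \<in> \<beta>" for A B
        using sub[OF that(1)] sub'[OF that(2)] disj by blast
      then show ?thesis
        by (simp cong: bex_cong)
    qed
    ultimately show ?thesis
      unfolding join_le_iff[OF fin_ab] le_ext_prod_iff[OF fin_ab spans]
        shadow_eq_iff[OF \<open>finite \<kappa>\<close> \<alpha>] shadow_eq_iff[OF \<open>finite \<kappa>\<close> \<beta>]
      by (simp add: ball_conj_distrib conj_ac cong: ball_cong)
  qed
  then show ?thesis
    unfolding am_interval_def by (simp cong: conj_cong)
qed

theorem card_AMT_disjoint_Un: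
  assumes fin: "finite P" "finite Q" and disj: "P \<inter> Q = {}"
  shows "card (AMT (P \<union> Q)) =
    1 + (\<Sum>(\<alpha>, \<beta>) \<in> (AMT P - {{}}) \<times> (AMT Q - {{}}).
           card (am_interval (P \<union> Q) (\<alpha> \<squnion> \<beta>) (\<alpha> \<otimes> \<beta>)))"
proof -
  let ?pairs = "(AMT P - {{}}) \<times> (AMT Q - {{}})"
  let ?shadows = "\<lambda>\<kappa>. (shadow P \<kappa>, shadow Q \<kappa>)"
  have finN: "finite (AMT (P \<union> Q))" and fin_pairs: "finite ?pairs"
    using fin by (simp_all add: finite_AMT)
  have nonempty: "shadow R \<kappa> = {} \<longleftrightarrow> \<kappa> = {}" if "\<kappa> \<in> AMT (P \<union> Q)" for R \<kappa>
    by (rule shadow_eq_empty_iff, rule finite_mem_AMT[OF _ that]) (use fin in simp)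
  have shadows: "?shadows ` (AMT (P \<union> Q) - {{}}) \<subseteq> ?pairs"
    by (auto simp: shadow_in_AMT nonempty)
  have interval: "am_interval (P \<union> Q) (fst p \<squnion> snd p) (fst p \<otimes> snd p) =
      {\<kappa> \<in> AMT (P \<union> Q) - {{}}. ?shadows \<kappa> = p}" if "p \<in> ?pairs" for p
  proof -
    obtain \<alpha> \<beta> where p: "p = (\<alpha>, \<beta>)" and mem: "\<alpha> \<in> AMT P" "\<beta> \<in> AMT Q" and "\<alpha> \<noteq> {}"
      using \<open>p \<in> ?pairs\<close> by (cases p) simp
    have "\<kappa> \<noteq> {}" if "shadow P \<kappa> = \<alpha>" for \<kappa>
      using that \<open>\<alpha> \<noteq> {}\<close> shadow_eq_empty_iff[of "{}" P] by force
    then show ?thesis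
      unfolding p fst_conv snd_conv am_interval_eq_shadow_fibre[OF assms mem] by auto
  qed
  have "{} \<in> AMT (P \<union> Q)"
    unfolding AMT_def by simp
  then have "card (AMT (P \<union> Q)) = 1 + card (AMT (P \<union> Q) - {{}})"
    using finN by (metis card.remove plus_1_eq_Suc)
  also have "card (AMT (P \<union> Q) - {{}}) =
      (\<Sum>p\<in>?pairs. card {\<kappa> \<in> AMT (P \<union> Q) - {{}}. ?shadows \<kappa> = p})"
    unfolding card_eq_sum by (rule sum.group[OF _ fin_pairs shadows, symmetric]) (use finN in simp)
  also have "\<dots> = (\<Sum>(\<alpha>, \<beta>)\<in>?pairs. card (am_interval (P \<union> Q) (\<alpha> \<squnion> \<beta>) (\<alpha> \<otimes> \<beta>)))"
    unfolding case_prod_beta by (rule sum.cong[OF refl]) (simp only: interval)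
  finally show ?thesis .
qed

theorem corollary6:
  fixes n1 n :: nat
  assumes "1 \<le> n1" and "n1 < n"
  shows "card (AMT {1..n}) =
    1 + (\<Sum>(\<alpha>, \<beta>) \<in> (AMT {1..n1} - {{}}) \<times> (AMT {n1+1..n} - {{}}).
           card (am_interval {1..n} (\<alpha> \<squnion> \<beta>) (\<alpha> \<otimes> \<beta>)))"
proof -
  have "{1..n} = {1..n1} \<union> {n1+1..n}"
    using assms by auto
  then show ?thesis
    using card_AMT_disjoint_Un[of "{1..n1}" "{n1+1..n}"] by simp
qed

end
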